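(* Let $a,b,c,d>0$ be real numbers and let $\{W_n(z)\}_{n\ge0}$ be the sequence of polynomials defined by $W_0(z)=1$, $W_1(z)=z$ and \[ W_n(z)=(az+b)W_{n-1}(z)+(cz+d)W_{n-2}(z)\qquad(n\ge2). \] Then every polynomial $W_n(z)$ is real-rooted (i.e. all its zeros are real) if and only if $ad\le bc$. *)

theory Defs
  imports "HOL-Analysis.Analysis" "HOL-Computational_Algebra.Computational_Algebra"
begin

fun W :: "real \<Rightarrow> real \<Rightarrow> real \<Rightarrow> real \<Rightarrow> nat \<Rightarrow> real poly" where
  "W a b c d 0 = 1"
| "W a b c d (Suc 0) = [:0, 1:]"
| "W a b c d (Suc (Suc n)) = [:b, a:] * W a b c d (Suc n) + [:d, c:] * W a b c d n"

text \<open>The zeros are taken in the complex numbers. Nonzero constants are real-rooted vacuously,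
  and the zero polynomial is not real-rooted.\<close>

definition real_rooted :: "real poly \<Rightarrow> bool" where
  "real_rooted p \<longleftrightarrow> (\<forall>z::complex. poly (map_poly of_real p) z = 0 \<longrightarrow> z \<in> \<real>)"

end

theory Submission
  imports Defs
begin

text \<open>
  Suppose \<open>a d \<le> b c\<close> and \<open>Im z > 0\<close>, and let \<open>\<alpha>\<close>, \<open>\<beta>\<close>, \<open>\<zeta>\<close> be the arguments of \<open>a z + b\<close>,
  \<open>c z + d\<close> and \<open>z\<close>. Then \<open>0 < \<alpha> \<le> \<beta> \<le> \<zeta> < \<pi>\<close>, and the recurrence
  \<open>R' = (a z + b) + (c z + d) / R\<close> for the ratios \<open>R\<close> of consecutive values of the sequence
  preserves the condition that \<open>R \<noteq> 0\<close> has an argument in \<open>[\<beta> - \<zeta>, \<zeta>]\<close>: the two summands have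
  arguments in this interval that differ by less than \<open>\<pi>\<close>. Hence no value vanishes.

  Conversely, if \<open>a d > b c\<close>, then the curve \<open>(a z + b)\<^sup>2 = - 4 cos\<^sup>2 \<phi> (c z + d)\<close>, \<open>\<phi>\<close> real, on which
  the two characteristic roots \<open>\<sigma> exp (\<plusminus> \<i> \<phi>)\<close> have equal modulus, leaves the real axis for \<open>\<phi>\<close> near
  \<open>\<pi> / 2\<close>. Extended to complex \<open>\<phi>\<close>, the zeros near this curve are the solutions of
  \<open>exp (2 \<i> n \<phi>) = G \<phi>\<close> with \<open>G\<close> continuous, nonzero and independent of \<open>n\<close>. For large \<open>n\<close>, Brouwer's
  theorem on a small disc gives a solution \<open>\<phi> = k \<pi> / n + log (G \<phi>) / (2 \<i> n)\<close>.
\<close>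

section \<open>Polar forms of sums and comparison of arguments\<close>

lemma Arg_in_upper_half_plane:
  assumes "Im z > 0"
  shows "0 < Arg z" "Arg z < pi"
  using assms Arg_lt_pi[of z] by simp_all

text \<open>For \<open>\<theta> < \<phi>\<close>, rotation by \<open>- \<theta>\<close> makes the
  first summand a positive real and puts the sum \<open>w\<close> into the upper half-plane.
  Rotating \<open>w\<close> further by \<open>- \<delta>\<close> takes it into the lower half-plane,
  which forces \<open>Arg w < \<delta>\<close>.\<close>

lemma rcis_add_between:
  assumes "r > 0" "s > 0" "\<theta> \<le> \<phi>" "\<phi> - \<theta> < pi"
  obtains t \<psi> where "t > 0" "\<theta> \<le> \<psi>" "\<psi> \<le> \<phi>" "rcis r \<theta> + rcis s \<phi> = rcis t \<psi>"
proof (cases "\<theta> = \<phi>")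
  case True
  then have "rcis r \<theta> + rcis s \<phi> = rcis (r + s) \<phi>"
    by (simp add: rcis_def algebra_simps)
  with True assms that[of "r + s" \<phi>] show thesis by simp
next
  case False
  define \<delta> where "\<delta> = \<phi> - \<theta>"
  define w where "w = of_real r + rcis s \<delta>"
  define \<psi> where "\<psi> = Arg w"
  have \<delta>: "0 < \<delta>" "\<delta> < pi" using False assms by (auto simp: \<delta>_def)
  then have sin: "sin \<delta> > 0" by (rule sin_gt_zero)
  have Im: "Im w > 0" using sin assms by (simp add: w_def)
  then have \<psi>: "0 < \<psi>" "\<psi> < pi" unfolding \<psi>_def by (simp_all add: Arg_in_upper_half_plane)
  have w: "w = rcis (norm w) \<psi>" by (simp add: \<psi>_def rcis_cmod_Arg)
  have pos: "norm w > 0" using Im by auto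
  have "norm w * sin (\<psi> - \<delta>) = Im (rcis (norm w) \<psi> * cis (- \<delta>))"
    by (simp add: rcis_def sin_diff algebra_simps)
  also have "\<dots> = Im (w * cis (- \<delta>))" using w by simp
  also have "\<dots> = - r * sin \<delta>"
    by (simp add: w_def algebra_simps)
  finally have "norm w * sin (\<psi> - \<delta>) < 0" using sin assms by simp
  then have "sin (\<psi> - \<delta>) < 0" using pos by (simp add: mult_less_0_iff)
  moreover have "sin (\<psi> - \<delta>) \<ge> 0" if "\<psi> \<ge> \<delta>"
    using that \<psi> \<delta> by (intro sin_ge_zero) auto
  ultimately have "\<psi> < \<delta>" by force
  have "rcis r \<theta> + rcis s \<phi> = cis \<theta> * w"
    by (simp add: w_def rcis_def \<delta>_def distrib_left mult.left_commute cis_mult)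
  also have "\<dots> = rcis (norm w) (\<theta> + \<psi>)"
    by (subst w) (simp add: rcis_def cis_mult mult.left_commute)
  finally show thesis
    using that[of "norm w" "\<theta> + \<psi>"] pos \<psi> \<open>\<psi> < \<delta>\<close> by (simp add: \<delta>_def)
qed

lemma rcis_add_in_interval:
  assumes "r > 0" "s > 0" "\<theta> \<in> {l..u}" "\<phi> \<in> {l..u}" "\<bar>\<phi> - \<theta>\<bar> < pi"
  obtains t \<psi> where "t > 0" "\<psi> \<in> {l..u}" "rcis r \<theta> + rcis s \<phi> = rcis t \<psi>"
proof (cases "\<theta> \<le> \<phi>")
  case True
  with assms have "\<phi> - \<theta> < pi" by auto
  from rcis_add_between[OF assms(1,2) True this] assms that show thesis
    by (metis atLeastAtMost_iff order_trans)
next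
  case False
  with assms have "\<phi> \<le> \<theta>" "\<theta> - \<phi> < pi" by auto
  from rcis_add_between[OF assms(2,1) this] assms that show thesis
    by (metis add.commute atLeastAtMost_iff order_trans)
qed

text \<open>\<open>Im (v * cnj u)\<close> has the sign of \<open>sin (Arg v - Arg u)\<close>, and
  arguments in (0, pi) differ by less than pi.\<close>

lemma Arg_le_Arg:
  assumes "Im u > 0" "Im v > 0" "Im (v * cnj u) \<ge> 0"
  shows "Arg u \<le> Arg v"
proof (rule ccontr)
  assume "\<not> Arg u \<le> Arg v"
  moreover have "0 < Arg u" "Arg u < pi" "0 < Arg v" "Arg v < pi"
    using assms by (simp_all add: Arg_in_upper_half_plane)
  ultimately have "sin (Arg u - Arg v) > 0" by (intro sin_gt_zero) auto
  moreover have "Im (rcis (norm v) (Arg v) * cnj (rcis (norm u) (Arg u)))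
      = - (norm u * norm v * sin (Arg u - Arg v))"
    by (simp add: sin_diff algebra_simps)
  moreover have "norm u > 0" "norm v > 0" using assms by auto
  ultimately show False
    using assms(3) by (auto simp: rcis_cmod_Arg mult_le_0_iff)
qed

section \<open>Absence of zeros in the upper half-plane\<close>

abbreviation cW :: "real \<Rightarrow> real \<Rightarrow> real \<Rightarrow> real \<Rightarrow> nat \<Rightarrow> complex \<Rightarrow> complex" where
  "cW a b c d n z \<equiv> poly (map_poly of_real (W a b c d n)) z"

lemma cW_simps:
  "cW a b c d 0 z = 1"
  "cW a b c d (Suc 0) z = z"
  "cW a b c d (Suc (Suc n)) z
     = (of_real a * z + of_real b) * cW a b c d (Suc n) z + (of_real c * z + of_real d) * cW a b c d n z"
proof -
  have hom: "map_poly complex_of_real (p + q) = map_poly of_real p + map_poly of_real q"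
    "map_poly complex_of_real (p * q) = map_poly of_real p * map_poly of_real q" for p q
    by (simp_all add: poly_eq_iff coeff_map_poly coeff_mult)
  show "cW a b c d 0 z = 1" "cW a b c d (Suc 0) z = z"
    by (simp_all add: map_poly_pCons)
  show "cW a b c d (Suc (Suc n)) z
     = (of_real a * z + of_real b) * cW a b c d (Suc n) z + (of_real c * z + of_real d) * cW a b c d n z"
    by (simp add: hom map_poly_pCons algebra_simps del: mult_pCons_left)
qed

declare W.simps [simp del]

lemma cW_nonzero_upper_half_plane:
  assumes pos: "a > 0" "c > 0" "d > 0" and le: "a * d \<le> b * c" and z: "Im z > 0"
  shows "cW a b c d n z \<noteq> 0"
proof -
  let ?A = "of_real a * z + of_real b" and ?B = "of_real c * z + of_real d"
  define \<alpha> \<beta> \<zeta> where "\<alpha> = Arg ?A" and "\<beta> = Arg ?B" and "\<zeta> = Arg z"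
  have Im: "Im ?A > 0" "Im ?B > 0" using pos z by simp_all
  \<comment> \<open>This identity is where \<open>a * d \<le> b * c\<close> enters.\<close>
  have "Im (?B * cnj ?A) = (b * c - a * d) * Im z" by (simp add: algebra_simps)
  then have "\<alpha> \<le> \<beta>" using Arg_le_Arg[OF Im] le z by (simp add: \<alpha>_def \<beta>_def)
  have "Im (z * cnj ?B) = d * Im z" by (simp add: algebra_simps)
  then have "\<beta> \<le> \<zeta>" using Arg_le_Arg[OF Im(2) z] pos z by (simp add: \<zeta>_def \<beta>_def)
  have "0 < \<alpha>" unfolding \<alpha>_def by (intro Arg_in_upper_half_plane Im)
  have "0 < \<zeta>" "\<zeta> < pi" using z by (simp_all add: \<zeta>_def Arg_in_upper_half_plane)
  have "cW a b c d n z \<noteq> 0 \<and>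
    (\<exists>r \<theta>. r > 0 \<and> \<theta> \<in> {\<beta> - \<zeta>..\<zeta>} \<and> cW a b c d (Suc n) z = rcis r \<theta> * cW a b c d n z)"
  proof (induction n)
    case 0
    have "z = rcis (norm z) \<zeta>" by (simp add: \<zeta>_def rcis_cmod_Arg)
    moreover have "norm z > 0" using z by auto
    moreover have "\<zeta> \<in> {\<beta> - \<zeta>..\<zeta>}" using \<open>\<beta> \<le> \<zeta>\<close> \<open>0 < \<zeta>\<close> by simp
    ultimately show ?case by (metis cW_simps(1,2) mult.right_neutral zero_neq_one)
  next
    case (Suc n)
    then obtain r \<theta> where r: "r > 0" "\<theta> \<in> {\<beta> - \<zeta>..\<zeta>}"
      and eq: "cW a b c d (Suc n) z = rcis r \<theta> * cW a b c d n z" and nz: "cW a b c d n z \<noteq> 0"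
      by blast
    have A: "?A = rcis (norm ?A) \<alpha>" by (simp add: \<alpha>_def rcis_cmod_Arg)
    have "?B / rcis r \<theta> = rcis (norm ?B) \<beta> / rcis r \<theta>" by (simp add: \<beta>_def rcis_cmod_Arg)
    then have B: "?B / rcis r \<theta> = rcis (norm ?B / r) (\<beta> - \<theta>)" by (simp add: rcis_divide)
    have "norm ?A > 0" using Im(1) by (metis less_irrefl zero_complex.simps(2) zero_less_norm_iff)
    moreover have "norm ?B / r > 0"
      using Im(2) r by (metis divide_pos_pos less_irrefl zero_complex.simps(2) zero_less_norm_iff)
    \<comment> \<open>The map from \<open>\<theta>\<close> to \<open>\<beta> - \<theta>\<close>
      reflects the interval onto itself, which explains its lower end
      \<open>\<beta> - \<zeta>\<close>.\<close>
    moreover have "\<alpha> \<in> {\<beta> - \<zeta>..\<zeta>}" "\<beta> - \<theta> \<in> {\<beta> - \<zeta>..\<zeta>}"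
      using r \<open>\<alpha> \<le> \<beta>\<close> \<open>\<beta> \<le> \<zeta>\<close> \<open>0 < \<alpha>\<close> by auto
    moreover have "\<bar>\<beta> - \<theta> - \<alpha>\<bar> < pi"
      using r \<open>\<alpha> \<le> \<beta>\<close> \<open>\<beta> \<le> \<zeta>\<close> \<open>0 < \<alpha>\<close> \<open>\<zeta> < pi\<close> by auto
    ultimately obtain t \<psi> where t: "t > 0" "\<psi> \<in> {\<beta> - \<zeta>..\<zeta>}"
      "rcis (norm ?A) \<alpha> + rcis (norm ?B / r) (\<beta> - \<theta>) = rcis t \<psi>"
      using rcis_add_in_interval by blast
    have nz': "rcis r \<theta> \<noteq> 0" using r by simp
    have "cW a b c d (Suc (Suc n)) z = (?A + ?B / rcis r \<theta>) * cW a b c d (Suc n) z"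
      using nz' by (simp add: cW_simps(3) eq field_simps)
    also have "?A + ?B / rcis r \<theta> = rcis t \<psi>" using A B t by simp
    finally show ?case using t nz nz' eq by auto
  qed
  then show ?thesis ..
qed

lemma real_rooted_W:
  assumes "a > 0" "c > 0" "d > 0" "a * d \<le> b * c"
  shows "real_rooted (W a b c d n)"
  unfolding real_rooted_def
proof (intro allI impI)
  fix z assume z: "cW a b c d n z = 0"
  \<comment> \<open>The coefficients are real, so conjugation reduces the lower half-plane to the
    upper one.\<close>
  have "cnj (cW a b c d n z) = cW a b c d n (cnj z)"
    by (subst poly_cnj) (simp add: map_poly_map_poly o_def)
  with z have "cW a b c d n (cnj z) = 0" by simp
  with z cW_nonzero_upper_half_plane[OF assms, of z n]
    cW_nonzero_upper_half_plane[OF assms, of "cnj z" n]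
  have "Im z = 0" by (force simp: not_less)
  then show "z \<in> \<real>" by (simp add: complex_is_Real_iff)
qed

section \<open>Closed form of the sequence\<close>

text \<open>The characteristic roots \<open>\<sigma> * exp (\<i> * \<phi>)\<close> and
  \<open>\<sigma> * exp (- (\<i> * \<phi>))\<close> have sum
  \<open>2 * \<sigma> * cos \<phi>\<close> and product \<open>\<sigma>^2\<close>. The factor
  \<open>\<sigma> * sin \<phi>\<close> avoids division, and
  \<open>of_nat n * \<phi> - \<phi>\<close> avoids a truncated \<open>n - 1\<close> at 0.\<close>

lemma cW_trigonometric:
  assumes "of_real a * z + of_real b = 2 * \<sigma> * cos \<phi>" "of_real c * z + of_real d = - \<sigma>\<^sup>2"
  shows "\<sigma> * sin \<phi> * cW a b c d n z
    = \<sigma> ^ n * (z * sin (of_nat n * \<phi>) - \<sigma> * sin (of_nat n * \<phi> - \<phi>))"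
proof -
  have sin_rec: "sin (x + \<phi>) = 2 * cos \<phi> * sin x - sin (x - \<phi>)" for x
    by (simp add: sin_add sin_diff)
  have "\<sigma> * sin \<phi> * cW a b c d n z
      = \<sigma> ^ n * (z * sin (of_nat n * \<phi>) - \<sigma> * sin (of_nat n * \<phi> - \<phi>)) \<and>
    \<sigma> * sin \<phi> * cW a b c d (Suc n) z
      = \<sigma> ^ Suc n * (z * sin (of_nat (Suc n) * \<phi>) - \<sigma> * sin (of_nat n * \<phi>))"
  proof (induction n)
    case 0
    show ?case by (simp add: cW_simps)
  next
    case (Suc n)
    define x where "x = of_nat n * \<phi> + \<phi>"
    have x: "of_nat (Suc n) * \<phi> = x" "of_nat (Suc (Suc n)) * \<phi> = x + \<phi>" "of_nat n * \<phi> = x - \<phi>"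
      "x - \<phi> - \<phi> = x - 2 * \<phi>"
      by (simp_all add: x_def algebra_simps)
    have sin_rec2: "sin (x - 2 * \<phi>) = 2 * cos \<phi> * sin (x - \<phi>) - sin x"
      using sin_rec[of "x - \<phi>"] by simp
    define p q where "p = cW a b c d n z" and "q = cW a b c d (Suc n) z"
    from Suc have p: "\<sigma> * sin \<phi> * p = \<sigma> ^ n * (z * sin (x - \<phi>) - \<sigma> * sin (x - 2 * \<phi>))"
      and q: "\<sigma> * sin \<phi> * q = \<sigma> ^ Suc n * (z * sin x - \<sigma> * sin (x - \<phi>))"
      unfolding p_def q_def x by simp_all
    have "\<sigma> * sin \<phi> * cW a b c d (Suc (Suc n)) z
        = 2 * \<sigma> * cos \<phi> * (\<sigma> * sin \<phi> * q) - \<sigma>\<^sup>2 * (\<sigma> * sin \<phi> * p)"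
      unfolding cW_simps(3) assms p_def q_def by (simp add: algebra_simps)
    also have "\<dots> = \<sigma> ^ Suc (Suc n) * (z * sin (x + \<phi>) - \<sigma> * sin x)"
      unfolding p q sin_rec sin_rec2 by (simp add: algebra_simps power2_eq_square)
    finally show ?case using q unfolding x q_def by simp
  qed
  then show ?thesis ..
qed

text \<open>With the sines written as exponentials, \<open>e\<close> says that the bracket in the
  closed form vanishes.\<close>

lemma cW_zero_trigonometric:
  assumes "of_real a * z + of_real b = 2 * \<sigma> * cos \<phi>" "of_real c * z + of_real d = - \<sigma>\<^sup>2"
    and "\<sigma> \<noteq> 0" "sin \<phi> \<noteq> 0"
    and e: "exp (2 * \<i> * of_nat n * \<phi>) * (z - \<sigma> * exp (- (\<i> * \<phi>))) = z - \<sigma> * exp (\<i> * \<phi>)"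
  shows "cW a b c d n z = 0"
proof -
  define x where "x = exp (\<i> * (of_nat n * \<phi>))"
  define y where "y = exp (\<i> * \<phi>)"
  have nz: "x \<noteq> 0" "y \<noteq> 0" by (simp_all add: x_def y_def)
  have "exp (2 * \<i> * of_nat n * \<phi>) = x * x"
    by (simp add: x_def flip: exp_add) (simp add: algebra_simps)
  with e have eq: "x * x * (z - \<sigma> / y) = z - \<sigma> * y" by (simp add: y_def exp_minus field_simps)
  have "sin (of_nat n * \<phi>) = (x - 1 / x) / (2 * \<i>)"
    by (simp add: sin_exp_eq x_def exp_minus field_simps)
  moreover have "sin (of_nat n * \<phi> - \<phi>) = (x / y - y / x) / (2 * \<i>)"
    unfolding sin_exp_eq x_def y_def by (simp add: exp_minus exp_diff right_diff_distrib field_simps)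
  ultimately have "z * sin (of_nat n * \<phi>) - \<sigma> * sin (of_nat n * \<phi> - \<phi>)
      = (x * x * (z - \<sigma> / y) - (z - \<sigma> * y)) / (2 * \<i> * x)"
    using nz by (simp only:) (simp add: divide_simps, simp add: algebra_simps)
  also have "\<dots> = 0" using eq by simp
  finally have "z * sin (of_nat n * \<phi>) - \<sigma> * sin (of_nat n * \<phi> - \<phi>) = 0" .
  then show ?thesis using cW_trigonometric[OF assms(1,2), of n] assms(3,4) by simp
qed


section \<open>Nonreal zeros from Brouwer's theorem\<close>

lemma exp_eq_near_real:
  fixes G :: "complex \<Rightarrow> complex" and x :: real
  assumes r: "r > 0" and cont: "continuous_on (cball (of_real x) r) G"
    and nz: "\<And>\<phi>. \<phi> \<in> cball (of_real x) r \<Longrightarrow> G \<phi> \<noteq> 0"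
  obtains n :: nat and \<phi> where "\<phi> \<in> cball (of_real x) r" "exp (2 * \<i> * of_nat n * \<phi>) = G \<phi>"
proof -
  obtain L where L: "continuous_on (cball (of_real x) r) L"
    and GL: "\<And>\<phi>. \<phi> \<in> cball (of_real x) r \<Longrightarrow> G \<phi> = exp (L \<phi>)"
    using continuous_logarithm_on_cball[OF cont nz] by blast
  have "bounded (L ` cball (of_real x) r)"
    by (intro compact_imp_bounded compact_continuous_image L compact_cball)
  then obtain M where M: "\<And>\<phi>. \<phi> \<in> cball (of_real x) r \<Longrightarrow> norm (L \<phi>) \<le> M"
    unfolding bounded_iff by blast
  \<comment> \<open>This makes \<open>(pi + M) / (2 * n)\<close>, the bound below for the distance
    from \<open>T \<phi>\<close> to \<open>x\<close>, at most \<open>r\<close>.\<close>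
  obtain n :: nat where n: "max 1 ((pi + M) / (2 * r)) < n" using reals_Archimedean2 by blast
  then have n0: "real n > 0" by simp
  have "(pi + M) / (2 * r) < n" using n by simp
  then have nr: "pi + M \<le> 2 * real n * r" using r by (simp add: field_simps)
  \<comment> \<open>\<open>k * pi / n\<close> is a multiple of \<open>pi / n\<close> nearest to
    \<open>x\<close>, hence within \<open>pi / (2 * n)\<close> of it.\<close>
  define k where "k = round (real n * x / pi)"
  have "\<bar>k - real n * x / pi\<bar> \<le> 1 / 2" unfolding k_def by (rule of_int_round_abs_le)
  then have "pi * \<bar>k - real n * x / pi\<bar> \<le> pi / 2" by simp
  also have "pi * \<bar>k - real n * x / pi\<bar> = \<bar>pi * (k - real n * x / pi)\<bar>" by (simp add: abs_mult)
  also have "pi * (k - real n * x / pi) = k * pi - n * x" by (simp add: field_simps)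
  finally have k: "\<bar>k * pi - n * x\<bar> \<le> pi / 2" .
  define T where "T \<phi> = (of_int k * of_real pi - \<i> * L \<phi> / 2) / of_nat n" for \<phi>
  have "continuous_on (cball (of_real x) r) T"
    unfolding T_def by (intro continuous_intros L) (use n0 in auto)
  moreover have "T \<in> cball (of_real x) r \<rightarrow> cball (of_real x) r"
  proof
    fix \<phi> :: complex assume \<phi>: "\<phi> \<in> cball (of_real x) r"
    have "of_nat n * (T \<phi> - of_real x) = of_real (k * pi - n * x) - \<i> * L \<phi> / 2"
      using n0 by (simp add: T_def field_simps)
    then have "real n * norm (T \<phi> - of_real x) = norm (of_real (k * pi - n * x) - \<i> * L \<phi> / 2)"
      by (metis norm_mult norm_of_nat)
    also have "\<dots> \<le> norm (complex_of_real (k * pi - n * x)) + norm (\<i> * L \<phi> / 2)"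
      by (rule norm_triangle_ineq4)
    also have "\<dots> \<le> pi / 2 + M / 2"
      using k M[OF \<phi>] by (intro add_mono) (simp_all only: norm_of_real, simp add: norm_mult)
    also have "\<dots> \<le> real n * r" using nr by simp
    finally have "norm (T \<phi> - of_real x) \<le> r" using n0 by simp
    then show "T \<phi> \<in> cball (of_real x) r" by (simp add: dist_norm norm_minus_commute)
  qed
  ultimately obtain \<phi> where \<phi>: "\<phi> \<in> cball (of_real x) r" "T \<phi> = \<phi>"
    using brouwer_ball[OF r] by blast
  then have "of_nat n * \<phi> = of_int k * of_real pi - \<i> * L \<phi> / 2"
    using n0 unfolding T_def by (simp add: field_simps)
  then have "2 * \<i> * of_nat n * \<phi> = L \<phi> + \<i> * of_int k * (of_real pi * 2)"
    by (simp add: mult.assoc) (simp add: algebra_simps)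
  then have "exp (2 * \<i> * of_nat n * \<phi>) = exp (L \<phi>)"
    by (metis exp_plus_2pin mult.commute mult.left_commute)
  with \<phi> GL that show thesis by simp
qed

text \<open>\<open>Z\<close> parametrizes the curve by complex \<open>\<phi>\<close>. Since
  \<open>cos \<phi>\<close> is nonzero, \<open>\<sigma>\<close> is obtained by division instead of a
  square root of \<open>- (c z + d)\<close>, so it inherits continuity from
  \<open>Z\<close>.\<close>

lemma cW_zero_on_curve:
  fixes Z :: "complex \<Rightarrow> complex" and x :: real
  assumes "a > 0" "r > 0" and cont: "continuous_on (cball (of_real x) r) Z"
    and trig: "\<And>\<phi>. \<phi> \<in> cball (complex_of_real x) r \<Longrightarrow> cos \<phi> \<noteq> 0 \<and> sin \<phi> \<noteq> 0"
    and Im: "\<And>\<phi>. \<phi> \<in> cball (of_real x) r \<Longrightarrow> Im (Z \<phi>) > 0"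
    and curve: "\<And>\<phi>. \<phi> \<in> cball (of_real x) r \<Longrightarrow>
      (of_real a * Z \<phi> + of_real b)\<^sup>2 = - 4 * (cos \<phi>)\<^sup>2 * (of_real c * Z \<phi> + of_real d)"
    and nonfix: "\<And>\<phi>. \<phi> \<in> cball (of_real x) r \<Longrightarrow>
      (Z \<phi>)\<^sup>2 \<noteq> (of_real a * Z \<phi> + of_real b) * Z \<phi> + (of_real c * Z \<phi> + of_real d)"
  obtains n z where "Im z > 0" "cW a b c d n z = 0"
proof -
  define \<sigma> where "\<sigma> \<phi> = (of_real a * Z \<phi> + of_real b) / (2 * cos \<phi>)" for \<phi>
  have cos: "of_real a * Z \<phi> + of_real b = 2 * \<sigma> \<phi> * cos \<phi>" if "\<phi> \<in> cball (of_real x) r" for \<phi>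
    using trig[OF that] by (simp add: \<sigma>_def)
  have sq: "of_real c * Z \<phi> + of_real d = - (\<sigma> \<phi>)\<^sup>2" if "\<phi> \<in> cball (of_real x) r" for \<phi>
    using trig[OF that] curve[OF that] by (simp add: \<sigma>_def power_divide power_mult_distrib)
  have \<sigma>: "\<sigma> \<phi> \<noteq> 0" if "\<phi> \<in> cball (of_real x) r" for \<phi>
  proof
    assume "\<sigma> \<phi> = 0"
    then have "Im (of_real a * Z \<phi> + of_real b) = 0" using cos[OF that] by simp
    then show False using Im[OF that] \<open>a > 0\<close> by simp
  qed
  have nz: "Z \<phi> - \<sigma> \<phi> * exp (\<i> * \<phi>) \<noteq> 0 \<and> Z \<phi> - \<sigma> \<phi> * exp (- (\<i> * \<phi>)) \<noteq> 0"
    if "\<phi> \<in> cball (of_real x) r" for \<phi>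
  proof -
    \<comment> \<open>The product is the characteristic polynomial evaluated at
      \<open>Z \<phi>\<close> itself, nonzero by \<open>nonfix\<close>.\<close>
    have "(Z \<phi> - \<sigma> \<phi> * exp (\<i> * \<phi>)) * (Z \<phi> - \<sigma> \<phi> * exp (- (\<i> * \<phi>)))
      = (Z \<phi>)\<^sup>2 - 2 * \<sigma> \<phi> * cos \<phi> * Z \<phi> + (\<sigma> \<phi>)\<^sup>2"
      by (simp add: cos_exp_eq exp_minus field_simps power2_eq_square)
    also have "\<dots> \<noteq> 0" using nonfix[OF that] unfolding cos[OF that] sq[OF that] by (auto simp: algebra_simps)
    finally show ?thesis by simp
  qed
  define G where "G \<phi> = (Z \<phi> - \<sigma> \<phi> * exp (\<i> * \<phi>)) / (Z \<phi> - \<sigma> \<phi> * exp (- (\<i> * \<phi>)))" for \<phi>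
  have "continuous_on (cball (of_real x) r) G"
    unfolding G_def \<sigma>_def
    by (intro continuous_intros cont) (use trig nz in \<open>auto simp: \<sigma>_def\<close>)
  moreover have "G \<phi> \<noteq> 0" if "\<phi> \<in> cball (of_real x) r" for \<phi>
    using nz[OF that] by (simp add: G_def)
  ultimately obtain n \<phi> where \<phi>: "\<phi> \<in> cball (of_real x) r" "exp (2 * \<i> * of_nat n * \<phi>) = G \<phi>"
    using exp_eq_near_real[OF \<open>r > 0\<close>] by blast
  then have "cW a b c d n (Z \<phi>) = 0"
    using nz[OF \<phi>(1)] trig[OF \<phi>(1)]
    by (intro cW_zero_trigonometric[OF cos sq \<sigma>]) (auto simp: G_def)
  with Im[OF \<phi>(1)] that show thesis by blast
qed

lemma cW_zero_upper_half_plane: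
  assumes pos: "a > 0" "b > 0" "c > 0" "d > 0" and gt: "a * d > b * c"
  obtains n z where "Im z > 0" "cW a b c d n z = 0"
proof -
  \<comment> \<open>With \<open>\<tau> = 4 * (cos \<phi>)^2\<close> the curve becomes the quadratic
    \<open>a^2 z^2 + (2 a b + \<tau> c) z + (b^2 + \<tau> d) = 0\<close> with discriminant
    \<open>- disc \<tau>\<close>; \<open>\<omega> \<tau>\<close> is one root.\<close>
  define D where "D = 4 * a * (a * d - b * c)"
  have D: "D > 0" using pos gt by (simp add: D_def)
  define disc where "disc \<tau> = \<tau> * (of_real D - \<tau> * of_real (c\<^sup>2))" for \<tau> :: complex
  define \<omega> where "\<omega> \<tau> = (- (2 * of_real (a * b) + \<tau> * of_real c) + \<i> * csqrt (disc \<tau>)) / of_real (2 * a\<^sup>2)"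
    for \<tau>
  have \<omega>: "(of_real a * \<omega> \<tau> + of_real b)\<^sup>2 = - \<tau> * (of_real c * \<omega> \<tau> + of_real d)" for \<tau>
  proof -
    define s where "s = csqrt (disc \<tau>)"
    have s: "s\<^sup>2 = disc \<tau>" by (simp add: s_def)
    define w where "w = \<omega> \<tau>"
    have w: "2 * of_real a ^ 2 * w + 2 * of_real a * of_real b + \<tau> * of_real c = \<i> * s"
      using pos by (simp add: w_def \<omega>_def s_def)
    have "4 * of_real a ^ 2 * ((of_real a * w + of_real b)\<^sup>2 + \<tau> * (of_real c * w + of_real d))
      = (2 * of_real a ^ 2 * w + 2 * of_real a * of_real b + \<tau> * of_real c)\<^sup>2 + disc \<tau>"
      by (simp add: disc_def D_def power2_eq_square algebra_simps)
    also have "\<dots> = 0" unfolding w using s by (simp add: power_mult_distrib)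
    finally have "(of_real a * w + of_real b)\<^sup>2 + \<tau> * (of_real c * w + of_real d) = 0"
      using pos by simp
    then show ?thesis
      unfolding w_def by (metis eq_neg_iff_add_eq_0 minus_mult_left)
  qed
  \<comment> \<open>The bound 4 allows \<open>t = 4 * (cos x)^2\<close> with \<open>x\<close> real
    and \<open>sin x\<close> nonzero; the bound \<open>D / c^2\<close> keeps \<open>disc\<close>
    positive and thus \<open>\<omega>\<close> nonreal.\<close>
  define t0 where "t0 = min 4 (D / c\<^sup>2)"
  have t0: "t0 > 0" using D pos by (simp add: t0_def)
  have disc: "disc (of_real t) = of_real (t * (D - t * c\<^sup>2))" "t * (D - t * c\<^sup>2) > 0"
    if "t \<in> {0<..<t0}" for t
    using that pos by (simp_all add: disc_def t0_def field_simps)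
  have Im\<omega>: "Im (\<omega> (of_real t)) > 0" if "t \<in> {0<..<t0}" for t
    using disc[OF that] pos by (simp add: \<omega>_def)
  have Re\<omega>: "Re (\<omega> (of_real t)) = - (2 * a * b + t * c) / (2 * a\<^sup>2)" if "t \<in> {0<..<t0}" for t
    using disc[OF that] pos by (simp add: \<omega>_def)
  \<comment> \<open>The roots of \<open>p\<close> are the points \<open>z\<close> that are themselves a characteristic root, where \<open>G\<close> is \<open>0\<close> or undefined.\<close>
  define p where "p = [:- of_real d, - of_real (b + c), 1 - of_real a :: complex:]"
  have "p \<noteq> 0" using pos by (simp add: p_def)
  then have "finite {z. poly p z = 0}" by (rule poly_roots_finite)
  \<comment> \<open>The real part is strictly monotone in \<open>t\<close>, so the arc has
    infinitely many points and one of them avoids the roots of \<open>p\<close>.\<close>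
  moreover have "inj_on (\<lambda>t. \<omega> (of_real t)) {0<..<t0}"
  proof (rule inj_onI)
    fix s t assume st: "s \<in> {0<..<t0}" "t \<in> {0<..<t0}" "\<omega> (of_real s) = \<omega> (of_real t)"
    then have "- (2 * a * b + s * c) / (2 * a\<^sup>2) = - (2 * a * b + t * c) / (2 * a\<^sup>2)"
      by (metis Re\<omega>)
    then show "s = t" using pos by simp
  qed
  then have "infinite ((\<lambda>t. \<omega> (of_real t)) ` {0<..<t0})"
    using t0 by (simp add: finite_image_iff)
  ultimately obtain t where t: "t \<in> {0<..<t0}" and pt: "poly p (\<omega> (of_real t)) \<noteq> 0"
    by (metis (mono_tags, lifting) finite_subset image_subset_iff mem_Collect_eq)
  define x where "x = arccos (sqrt t / 2)"
  have t4: "0 < t" "t < 4" using t by (auto simp: t0_def)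
  then have sqrt: "0 < sqrt t / 2" "sqrt t / 2 < 1" using real_sqrt_less_mono[of t 4] by simp_all
  have cosx: "cos x = sqrt t / 2"
    unfolding x_def by (rule cos_arccos) (use sqrt in linarith)+
  have x: "0 < x" "x < pi"
    using arccos_lt_bounded[of "sqrt t / 2"] sqrt unfolding x_def by linarith+
  have \<tau>x: "4 * (cos (complex_of_real x))\<^sup>2 = of_real t"
    using t4 by (simp add: cos_of_real cosx power_divide flip: of_real_power)
  define Z where "Z \<phi> = \<omega> (4 * (cos \<phi>)\<^sup>2)" for \<phi>
  \<comment> \<open>On \<open>U\<close> the argument of \<open>csqrt\<close> stays off its branch
    cut.\<close>
  define U where "U = {\<phi>. Re (disc (4 * (cos \<phi>)\<^sup>2)) > 0}"
  have "open U"
    unfolding U_def disc_def by (intro open_Collect_less continuous_intros)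
  have "continuous_on U (\<lambda>\<phi>. csqrt (disc (4 * (cos \<phi>)\<^sup>2)))"
  proof (rule continuous_on_compose2[OF continuous_on_csqrt])
    show "continuous_on U (\<lambda>\<phi>. disc (4 * (cos \<phi>)\<^sup>2))"
      unfolding disc_def by (intro continuous_intros)
  qed (auto simp: U_def complex_nonpos_Reals_iff)
  then have contZ: "continuous_on U Z"
    unfolding Z_def \<omega>_def by (intro continuous_intros) (use pos in auto)
  have xU: "of_real x \<in> U" using disc[OF t] by (simp add: U_def \<tau>x)
  let ?P = "\<lambda>\<phi>. cos \<phi> * sin \<phi> * poly p (Z \<phi>)"
  \<comment> \<open>All conditions needed on the disc are open and hold at \<open>x\<close>, so they
    hold on a small ball around it.\<close>
  define V where "V = U \<inter> {\<phi>. Im (Z \<phi>) > 0 \<and> ?P \<phi> \<noteq> 0}"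
  have "V = (U \<inter> (\<lambda>\<phi>. Im (Z \<phi>)) -` {0<..}) \<inter> (U \<inter> ?P -` (-{0}))"
    by (auto simp: V_def)
  also have "open \<dots>"
  proof (rule open_Int; rule continuous_open_preimage[OF _ \<open>open U\<close>])
    show "continuous_on U (\<lambda>\<phi>. Im (Z \<phi>))" "continuous_on U ?P"
      by (intro continuous_intros contZ)+
  qed (simp_all add: open_Compl)
  finally have "open V" .
  have "sin x \<noteq> 0" using sin_gt_zero[OF x] by simp
  then have "cos (complex_of_real x) \<noteq> 0" "sin (complex_of_real x) \<noteq> 0"
    using t4 by (simp_all add: cos_of_real sin_of_real cosx)
  then have "of_real x \<in> V"
    using xU Im\<omega>[OF t] pt by (simp add: V_def Z_def \<tau>x)
  then obtain r where r: "r > 0" "cball (of_real x) r \<subseteq> V"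
    using \<open>open V\<close> open_contains_cball by blast
  show thesis
  proof (rule cW_zero_on_curve[OF \<open>a > 0\<close> \<open>r > 0\<close>])
    show "continuous_on (cball (of_real x) r) Z"
      using contZ r by (rule_tac continuous_on_subset) (auto simp: V_def)
    fix \<phi> assume "\<phi> \<in> cball (complex_of_real x) r"
    then have \<phi>: "\<phi> \<in> V" using r by blast
    then show "cos \<phi> \<noteq> 0 \<and> sin \<phi> \<noteq> 0" "Im (Z \<phi>) > 0" by (auto simp: V_def)
    show "(of_real a * Z \<phi> + of_real b)\<^sup>2 = - 4 * (cos \<phi>)\<^sup>2 * (of_real c * Z \<phi> + of_real d)"
      by (simp add: Z_def \<omega>)
    have "poly p (Z \<phi>) \<noteq> 0" using \<phi> by (simp add: V_def)
    then show "(Z \<phi>)\<^sup>2 \<noteq> (of_real a * Z \<phi> + of_real b) * Z \<phi> + (of_real c * Z \<phi> + of_real d)"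
      by (simp add: p_def algebra_simps power2_eq_square)
  qed (rule that)
qed

theorem theorem2p1:
  fixes a b c d :: real
  assumes "a > 0" and "b > 0" and "c > 0" and "d > 0"
  shows "(\<forall>n. real_rooted (W a b c d n)) \<longleftrightarrow> a * d \<le> b * c"
proof
  assume rr: "\<forall>n. real_rooted (W a b c d n)"
  show "a * d \<le> b * c"
  proof (rule ccontr)
    assume "\<not> a * d \<le> b * c"
    then have "a * d > b * c" by simp
    then obtain n z where z: "Im z > 0" "cW a b c d n z = 0"
      by (rule cW_zero_upper_half_plane[OF assms])
    from rr have "real_rooted (W a b c d n)" ..
    with z(2) have "z \<in> \<real>" unfolding real_rooted_def by blast
    with z(1) show False by (simp add: complex_is_Real_iff)
  qed
next
  assume "a * d \<le> b * c"
  then show "\<forall>n. real_rooted (W a b c d n)"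
    by (intro allI real_rooted_W assms)
qed

end
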